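(* Let $\mathscr{A}$ be a Banach algebra with unit $I$, and let $P, Q \in \mathscr{A}$ be idempotents with $PQ = QP$. Then for any nonzero scalars $a$ and $b$, the element $aP+bQ$ is Drazin invertible, $\operatorname{ind}(aP+bQ)\le 1$, and $$(aP+bQ)^D=\begin{cases}\dfrac{1}{a}P+\dfrac{1}{b}Q+\Big(\dfrac{1}{a+b}-\dfrac{1}{a}-\dfrac{1}{b}\Big)PQ, & \text{if } a+b\neq 0;\\[2mm] \dfrac{1}{a}(P-Q), & \text{if } a+b=0.\end{cases}$$ Moreover, when $a+b\neq 0$, $\operatorname{ind}(aP+bQ)=0$ if and only if $P+Q=I+PQ$; while $\operatorname{ind}(aP-aQ)=0$ if and only if $P+Q=I+2PQ$.
   Context: An element $P \in \mathscr{A}$ is an idempotent if $P^2=P$. An element $A \in \mathscr{A}$ is Drazin invertible if there is $B \in \mathscr{A}$ with $BAB=B$, $AB=BA$ and $A^{k+1}B=A^k$ for some nonnegative integer $k$ (with $A^0=I$). Such a $B$ is unique, is called the Drazin inverse of $A$ and is denoted $A^D$. The least such $k$ is the index of $A$, denoted $\operatorname{ind}(A)$. Scalars are elements of the base field of $\mathscr{A}$. *)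

theory Defs
  imports Complex_Main
begin

text \<open>
  A unital Banach algebra over its base field. A (multiplicatively) normed real field is isomorphic
  to the reals or to the complex numbers, so a scalar type of class \<open>real_normed_field\<close> covers
  exactly real and complex Banach algebras; the underlying real structure comes from the type
  class, and \<open>scale_of_real\<close> says that it is the restriction of the base field's action. The unit
  is not required to have norm 1, nor to differ from 0, which is why the sort is not
  \<open>real_normed_algebra_1\<close>.
\<close>

locale banach_algebra = vector_space scale
  for scale :: "'k::real_normed_field \<Rightarrow> 'a::{real_normed_algebra, banach, monoid_mult} \<Rightarrow> 'a"
      (infixr \<open>*\<^sub>K\<close> 75) +
  assumes scale_mult_left: "(c *\<^sub>K x) * y = c *\<^sub>K (x * y)"
    and scale_mult_right: "x * (c *\<^sub>K y) = c *\<^sub>K (x * y)"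
    and norm_scale: "norm (c *\<^sub>K x) = norm c * norm x"
    and scale_of_real: "of_real r *\<^sub>K x = r *\<^sub>R x"

lemma banach_algebra_scaleR:
  "banach_algebra (scaleR :: real \<Rightarrow> 'a \<Rightarrow> 'a::{real_normed_algebra, banach, monoid_mult})"
  by unfold_locales (simp_all add: algebra_simps)

lemma banach_algebra_times:
  "banach_algebra ((*) :: 'k \<Rightarrow> 'k \<Rightarrow> 'k::{real_normed_field, banach})"
  by unfold_locales (simp_all add: algebra_simps norm_mult scaleR_conv_of_real)

definition is_drazin_inverse :: "'a::monoid_mult \<Rightarrow> 'a \<Rightarrow> bool" where
  "is_drazin_inverse A B \<longleftrightarrow> B * A * B = B \<and> A * B = B * A \<and> (\<exists>k. A ^ (k + 1) * B = A ^ k)"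

definition drazin_invertible :: "'a::monoid_mult \<Rightarrow> bool" where
  "drazin_invertible A \<longleftrightarrow> (\<exists>B. is_drazin_inverse A B)"

definition drazin_inverse :: "'a::monoid_mult \<Rightarrow> 'a" where
  "drazin_inverse A = (THE B. is_drazin_inverse A B)"

text \<open>The inverse and the index are meaningful only for Drazin invertible elements.\<close>

definition drazin_index :: "'a::monoid_mult \<Rightarrow> nat" where
  "drazin_index A = (LEAST k. A ^ (k + 1) * drazin_inverse A = A ^ k)"

lemma drazin_power_mono:
  fixes A B :: "'a::monoid_mult"
  assumes "A ^ (k + 1) * B = A ^ k" and "k \<le> n"
  shows "A ^ (n + 1) * B = A ^ n"
proof -
  from \<open>k \<le> n\<close> obtain m where n: "n = m + k" by (metis le_add_diff_inverse2)
  have "A ^ (n + 1) * B = A ^ m * (A ^ (k + 1) * B)"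
    unfolding n by (simp only: power_add mult.assoc)
  then show ?thesis unfolding assms(1) n by (simp add: power_add)
qed

lemma drazin_reduce:
  fixes A B :: "'a::monoid_mult"
  assumes "B * A * B = B" and "A * B = B * A"
  shows "A ^ n * B ^ (n + 1) = B" and "B ^ (n + 1) * A ^ n = B"
proof -
  show *: "A ^ n * B ^ (n + 1) = B"
  proof (induction n)
    case (Suc n)
    have "A ^ Suc n * B ^ (Suc n + 1) = A * (A ^ n * B ^ (n + 1)) * B"
      by (simp only: power_Suc power_commutes mult.assoc Suc_eq_plus1[symmetric])
    also have "\<dots> = B" using Suc assms by simp
    finally show ?case .
  qed simp
  have "B ^ (n + 1) * A ^ n = A ^ n * B ^ (n + 1)"
    using assms(2) by (metis power_commuting_commutes)
  with * show "B ^ (n + 1) * A ^ n = B" by simp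
qed

lemma is_drazin_inverse_unique:
  fixes A B C :: "'a::monoid_mult"
  assumes B: "is_drazin_inverse A B" and C: "is_drazin_inverse A C"
  shows "B = C"
proof -
  obtain k l where "A ^ (k + 1) * B = A ^ k" "A ^ (l + 1) * C = A ^ l"
    using B C unfolding is_drazin_inverse_def by blast
  then obtain n where nB: "A ^ (n + 1) * B = A ^ n" and nC: "A ^ (n + 1) * C = A ^ n"
    using drazin_power_mono by (metis nat_le_linear)
  have bB: "B * A * B = B" and cB: "A * B = B * A" using B by (auto simp: is_drazin_inverse_def)
  have bC: "C * A * C = C" and cC: "A * C = C * A" using C by (auto simp: is_drazin_inverse_def)
  have "B = B ^ (n + 1) * A ^ n" using drazin_reduce(2)[OF bB cB] by simp
  also have "\<dots> = B ^ (n + 1) * A ^ n * A * C" using nC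
    by (metis power_Suc2 Suc_eq_plus1 mult.assoc)
  also have "\<dots> = B * A * C" using drazin_reduce(2)[OF bB cB] by simp
  finally have 1: "B = B * A * C" .
  have "A ^ (n + 1) * B = B * A ^ (n + 1)"
    using cB by (metis power_commuting_commutes)
  then have "C = B * A ^ (n + 1) * C ^ (n + 1)"
    using drazin_reduce(1)[OF bC cC, of n] nB by simp
  also have "\<dots> = B * A * (A ^ n * C ^ (n + 1))"
    by (simp only: power_Suc mult.assoc Suc_eq_plus1[symmetric])
  also have "\<dots> = B * A * C" using drazin_reduce(1)[OF bC cC] by simp
  finally show ?thesis using 1 by simp
qed

lemma drazin_inverse_eq: "is_drazin_inverse A B \<Longrightarrow> drazin_inverse A = B"
  unfolding drazin_inverse_def using is_drazin_inverse_unique by blast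

end

theory Submission
  imports Defs
begin

text \<open>
  Two commuting idempotents \<open>P\<close> and \<open>Q\<close> generate the three mutually orthogonal idempotents
  \<open>P - PQ\<close>, \<open>Q - PQ\<close> and \<open>PQ\<close>. Their linear combinations multiply coordinatewise
  (\<open>orthogonal_combination_mult\<close>), as in the algebra of triples of scalars, and in these
  coordinates \<open>aP + bQ\<close> is the triple \<open>(a, b, a + b)\<close>. A triple is Drazin inverted by inverting its
  nonzero coordinates and keeping the zero ones (\<open>orthogonal_combination_drazin\<close>). Every
  scalar \<open>c\<close> satisfies \<open>c * c * inverse c = c\<close>, hence \<open>A * A * B = A\<close> for \<open>A = aP + bQ\<close> and its
  Drazin inverse \<open>B\<close>, which bounds the index by \<open>1\<close>. Rewritten in terms of
  \<open>P\<close>, \<open>Q\<close> and \<open>PQ\<close>, the triple of inverses is the stated formula; the case distinction on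
  \<open>a + b\<close> only records whether the third coordinate is inverted or stays \<open>0\<close>.

  The index is \<open>0\<close> exactly when the element times its Drazin inverse is the unit. This product
  is the sum of the orthogonal idempotents with nonzero coordinate: it is
  \<open>P + Q - PQ\<close> if \<open>a + b \<noteq> 0\<close>, and \<open>P + Q - 2PQ\<close> if \<open>a + b = 0\<close>.
\<close>

lemma drazin_index_eq_0_iff:
  assumes "is_drazin_inverse A B"
  shows "drazin_index A = 0 \<longleftrightarrow> A * B = 1"
proof -
  let ?stable = "\<lambda>k. A ^ (k + 1) * B = A ^ k"
  have index: "drazin_index A = (LEAST k. ?stable k)"
    unfolding drazin_index_def drazin_inverse_eq[OF assms] ..
  have "\<exists>k. ?stable k"
    using assms unfolding is_drazin_inverse_def by blast
  then have "?stable (LEAST k. ?stable k)"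
    by (rule LeastI_ex)
  moreover have "(LEAST k. ?stable k) = 0" if "?stable 0"
    using Least_le[of ?stable, OF that] by simp
  ultimately have "drazin_index A = 0 \<longleftrightarrow> ?stable 0"
    unfolding index by metis
  then show ?thesis by simp
qed

lemma drazin_index_le_1:
  assumes "is_drazin_inverse A B" and "A * A * B = A"
  shows "drazin_index A \<le> 1"
  unfolding drazin_index_def drazin_inverse_eq[OF assms(1)]
  by (rule Least_le) (use assms(2) in simp)

context banach_algebra
begin

lemma orthogonal_combination_mult:
  assumes "E * E = E" "F * F = F" "G * G = G"
    and "E * F = 0" "F * E = 0" "E * G = 0" "G * E = 0" "F * G = 0" "G * F = 0"
  shows "(x *\<^sub>K E + y *\<^sub>K F + z *\<^sub>K G) * (x' *\<^sub>K E + y' *\<^sub>K F + z' *\<^sub>K G)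
    = (x * x') *\<^sub>K E + (y * y') *\<^sub>K F + (z * z') *\<^sub>K G"
  by (simp add: distrib_left distrib_right scale_mult_left scale_mult_right assms mult.commute)

text \<open>
  Since \<open>inverse 0 = 0\<close>, the scalar \<open>inverse x\<close> is the Drazin inverse of \<open>x\<close> even for \<open>x = 0\<close>, so
  the defining equations hold in each coordinate.
\<close>

lemma orthogonal_combination_drazin:
  fixes E F G :: 'a and x y z :: 'k
  assumes orth: "E * E = E" "F * F = F" "G * G = G"
      "E * F = 0" "F * E = 0" "E * G = 0" "G * E = 0" "F * G = 0" "G * F = 0"
  defines "A \<equiv> x *\<^sub>K E + y *\<^sub>K F + z *\<^sub>K G"
    and "B \<equiv> inverse x *\<^sub>K E + inverse y *\<^sub>K F + inverse z *\<^sub>K G"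
  shows "is_drazin_inverse A B" and "A * A * B = A"
proof -
  note mult = orthogonal_combination_mult[OF orth]
  have cancel: "c * c * inverse c = c" "inverse c * c * inverse c = inverse c" for c :: 'k
    by (cases "c = 0"; simp)+
  show AAB: "A * A * B = A"
    unfolding A_def B_def mult cancel ..
  have "B * A * B = B"
    unfolding A_def B_def mult cancel ..
  moreover have "A * B = B * A"
    unfolding A_def B_def mult by (simp add: mult.commute)
  moreover have "A ^ (1 + 1) * B = A ^ 1"
    using AAB by simp
  ultimately show "is_drazin_inverse A B"
    unfolding is_drazin_inverse_def by blast
qed

text \<open>
  The two cases on \<open>a + b\<close> are treated at once, by writing the coefficient of \<open>PQ\<close> in the Drazin
  inverse as \<open>inverse (a + b) - inverse a - inverse b\<close>: if \<open>a + b = 0\<close>, the first term is \<open>0\<close> and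
  the other two cancel.
\<close>

lemma commuting_idempotents_drazin:
  fixes P Q :: 'a and a b :: 'k
  assumes P: "P * P = P" and Q: "Q * Q = Q" and comm: "P * Q = Q * P"
    and nz: "a \<noteq> 0" "b \<noteq> 0"
  defines "A \<equiv> a *\<^sub>K P + b *\<^sub>K Q"
    and "B \<equiv> inverse a *\<^sub>K P + inverse b *\<^sub>K Q
      + (inverse (a + b) - inverse a - inverse b) *\<^sub>K (P * Q)"
  shows "is_drazin_inverse A B" and "A * A * B = A"
    and "A * B = P + Q - (if a + b \<noteq> 0 then P * Q else P * Q + P * Q)"
proof -
  let ?E = "P - P * Q" and ?F = "Q - P * Q" and ?G = "P * Q"
  have absorb: "P * (P * Q) = P * Q" "Q * (P * Q) = P * Q" "P * Q * P = P * Q" "P * Q * Q = P * Q"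
    by (metis P Q comm mult.assoc)+
  then have idem: "P * Q * (P * Q) = P * Q"
    by (simp add: mult.assoc)
  have orth: "?E * ?E = ?E" "?F * ?F = ?F" "?G * ?G = ?G"
    "?E * ?F = 0" "?F * ?E = 0" "?E * ?G = 0" "?G * ?E = 0" "?F * ?G = 0" "?G * ?F = 0"
    by (simp_all add: left_diff_distrib right_diff_distrib P Q absorb idem comm[symmetric])
  have A: "A = a *\<^sub>K ?E + b *\<^sub>K ?F + (a + b) *\<^sub>K ?G"
    unfolding A_def by (simp add: scale_left_distrib scale_right_diff_distrib)
  have B: "B = inverse a *\<^sub>K ?E + inverse b *\<^sub>K ?F + inverse (a + b) *\<^sub>K ?G"
    unfolding B_def by (simp add: scale_left_diff_distrib scale_right_diff_distrib)
  show "is_drazin_inverse A B" "A * A * B = A"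
    unfolding A B by (rule orthogonal_combination_drazin[OF orth])+
  have "A * B = ?E + ?F + ((a + b) * inverse (a + b)) *\<^sub>K ?G"
    unfolding A B orthogonal_combination_mult[OF orth] using nz by simp
  then show "A * B = P + Q - (if a + b \<noteq> 0 then P * Q else P * Q + P * Q)"
    by simp
qed

end

theorem theorem2p4:
  fixes scale :: "'k::real_normed_field \<Rightarrow> 'a::{real_normed_algebra, banach, monoid_mult} \<Rightarrow> 'a"
      (infixr \<open>*\<^sub>K\<close> 75)
    and P Q :: 'a
    and a b :: 'k
  assumes "banach_algebra scale"
    and "P ^ 2 = P"
    and "Q ^ 2 = Q"
    and "P * Q = Q * P"
    and "a \<noteq> 0"
    and "b \<noteq> 0"
  shows "drazin_invertible (a *\<^sub>K P + b *\<^sub>K Q)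
    \<and> drazin_index (a *\<^sub>K P + b *\<^sub>K Q) \<le> 1
    \<and> drazin_inverse (a *\<^sub>K P + b *\<^sub>K Q) =
        (if a + b \<noteq> 0
         then (1 / a) *\<^sub>K P + (1 / b) *\<^sub>K Q + (1 / (a + b) - 1 / a - 1 / b) *\<^sub>K (P * Q)
         else (1 / a) *\<^sub>K (P - Q))
    \<and> (a + b \<noteq> 0 \<longrightarrow>
        (drazin_index (a *\<^sub>K P + b *\<^sub>K Q) = 0 \<longleftrightarrow> P + Q = 1 + P * Q))
    \<and> (drazin_index (a *\<^sub>K P - a *\<^sub>K Q) = 0 \<longleftrightarrow> P + Q = 1 + 2 *\<^sub>K (P * Q))"
proof -
  interpret banach_algebra scale by fact
  have P: "P * P = P" and Q: "Q * Q = Q"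
    using assms(2,3) by (simp_all add: power2_eq_square)
  let ?A = "a *\<^sub>K P + b *\<^sub>K Q"
  let ?B = "inverse a *\<^sub>K P + inverse b *\<^sub>K Q
      + (inverse (a + b) - inverse a - inverse b) *\<^sub>K (P * Q)"
  note AB = commuting_idempotents_drazin[OF P Q assms(4) assms(5,6)]
  have formula: "?B = (if a + b \<noteq> 0
      then (1 / a) *\<^sub>K P + (1 / b) *\<^sub>K Q + (1 / (a + b) - 1 / a - 1 / b) *\<^sub>K (P * Q)
      else (1 / a) *\<^sub>K (P - Q))"
  proof (cases "a + b = 0")
    case True
    then have "b = - a" by (simp add: eq_neg_iff_add_eq_0 add.commute)
    then show ?thesis
      by (simp add: inverse_eq_divide scale_right_diff_distrib)
  qed (simp add: inverse_eq_divide)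
  have "drazin_invertible ?A"
    unfolding drazin_invertible_def using AB(1) by blast
  moreover have "drazin_index ?A \<le> 1"
    using AB(1,2) by (rule drazin_index_le_1)
  moreover have "drazin_inverse ?A = ?B"
    using AB(1) by (rule drazin_inverse_eq)
  moreover have "drazin_index ?A = 0 \<longleftrightarrow> P + Q = 1 + P * Q" if "a + b \<noteq> 0"
    unfolding drazin_index_eq_0_iff[OF AB(1)] AB(3) using that by (simp add: diff_eq_eq)
  moreover have "drazin_index (a *\<^sub>K P - a *\<^sub>K Q) = 0 \<longleftrightarrow> P + Q = 1 + 2 *\<^sub>K (P * Q)"
  proof -
    have "- a \<noteq> 0" using assms(5) by simp
    note AB' = commuting_idempotents_drazin[OF P Q assms(4) assms(5) this]
    have diff: "a *\<^sub>K P - a *\<^sub>K Q = a *\<^sub>K P + (- a) *\<^sub>K Q" by simp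
    have two: "2 *\<^sub>K (P * Q) = P * Q + P * Q"
      using scale_left_distrib[of 1 1 "P * Q"] by simp
    show ?thesis
      unfolding diff drazin_index_eq_0_iff[OF AB'(1)] AB'(3) two by (simp add: diff_eq_eq)
  qed
  ultimately show ?thesis
    unfolding formula by blast
qed

end
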